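(* Let $X$ be a nonempty set, $d$ a metric on $X$, $\le$ a quasi-order (reflexive and transitive relation) on $X$, and $T:X\to X$ a map. For $x,y\in X$ write $x<>y$ if $x\le y$ or $y\le x$. Suppose that (i) $T$ is $(d,<>;\lambda)$-contractive for some $\lambda\in(0,1)$; (ii) $X$ is $(d,<>)$-complete and $(<>)$ is $d$-almost-selfclosed; (iii) $T$ is $(<>)$-increasing and $(<>)^\omega$-semi-progressive. Then $T$ is $(<>)^\omega$-global strongly Picard (modulo $(d,(<>)^\omega)$).
   Context: $\mathrm{Fix}(T)=\{x\in X: Tx=x\}$. $x(<>)^\omega y$ iff there are $k\ge2$ and $z_1,\dots,z_k\in X$ with $z_1=x$, $z_k=y$ and $z_i<>z_{i+1}$ for $1\le i\le k-1$. $T$ is $(d,<>;\lambda)$-contractive if $d(Tx,Ty)\le\lambda d(x,y)$ for all $x,y\in X$ with $x<>y$. A sequence $(z_n)$ in $X$ is $(<>)$-ascending if $z_i<>z_{i+1}$ for every $i$. $X$ is $(d,<>)$-complete if every $(<>)$-ascending $d$-Cauchy sequence in $X$ is $d$-convergent in $X$. $(<>)$ is $d$-almost-selfclosed if, whenever $(z_n)$ is $(<>)$-ascending and $d$-converges to $z\in X$, there is a subsequence $(w_n)$ of $(z_n)$ with $w_n<>z$ for all $n$. $T$ is $(<>)$-increasing if $x<>y$ implies $Tx<>Ty$. Put $X(T,(<>)^\omega)=\{x\in X: x(<>)^\omega Tx\}$; $T$ is $(<>)^\omega$-semi-progressive if this set is nonempty. $T$ is $(<>)^\omega$-global strongly Picard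 (modulo $(d,(<>)^\omega)$) if: (a) for each $x\in X(T,(<>)^\omega)$, the sequence $(T^nx)_{n\ge0}$ is $d$-convergent and its limit belongs to $\mathrm{Fix}(T)$; and (b) for all $z_1,z_2\in\mathrm{Fix}(T)$, $z_1(<>)^\omega z_2$ implies $z_1=z_2$. *)

theory Defs
  imports "HOL-Analysis.Analysis"
begin

text \<open>
  The space is a carrier set \<open>X\<close> with a distance \<open>d\<close> (library locale \<open>Metric_space\<close>); all
  relations, sequences and quantifiers are relativised to \<open>X\<close>. The notions are stated
  for an arbitrary relation \<open>R\<close>; in the theorem \<open>R\<close> is \<open>comparable le\<close>.
\<close>

definition comparable :: "('a \<Rightarrow> 'a \<Rightarrow> bool) \<Rightarrow> 'a \<Rightarrow> 'a \<Rightarrow> bool" where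
  "comparable le x y \<longleftrightarrow> le x y \<or> le y x"

definition chain_rel :: "'a set \<Rightarrow> ('a \<Rightarrow> 'a \<Rightarrow> bool) \<Rightarrow> 'a \<Rightarrow> 'a \<Rightarrow> bool" where
  "chain_rel X R x y \<longleftrightarrow>
     (\<exists>k\<ge>2. \<exists>z :: nat \<Rightarrow> 'a. (\<forall>i\<in>{1..k}. z i \<in> X) \<and> z 1 = x \<and> z k = y \<and>
        (\<forall>i\<in>{1..k-1}. R (z i) (z (i + 1))))"

definition Fix_on :: "'a set \<Rightarrow> ('a \<Rightarrow> 'a) \<Rightarrow> 'a set" where
  "Fix_on X T = {x \<in> X. T x = x}"

definition contractive_on ::
  "'a set \<Rightarrow> ('a \<Rightarrow> 'a \<Rightarrow> real) \<Rightarrow> ('a \<Rightarrow> 'a \<Rightarrow> bool) \<Rightarrow> real \<Rightarrow> ('a \<Rightarrow> 'a) \<Rightarrow> bool" where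
  "contractive_on X d R c T \<longleftrightarrow> (\<forall>x\<in>X. \<forall>y\<in>X. R x y \<longrightarrow> d (T x) (T y) \<le> c * d x y)"

definition ascending_in :: "'a set \<Rightarrow> ('a \<Rightarrow> 'a \<Rightarrow> bool) \<Rightarrow> (nat \<Rightarrow> 'a) \<Rightarrow> bool" where
  "ascending_in X R z \<longleftrightarrow> range z \<subseteq> X \<and> (\<forall>i. R (z i) (z (Suc i)))"

definition rel_complete ::
  "'a set \<Rightarrow> ('a \<Rightarrow> 'a \<Rightarrow> real) \<Rightarrow> ('a \<Rightarrow> 'a \<Rightarrow> bool) \<Rightarrow> bool" where
  "rel_complete X d R \<longleftrightarrow>
     (\<forall>z. ascending_in X R z \<and> Metric_space.MCauchy X d z \<longrightarrow>
        (\<exists>l. limitin (Metric_space.mtopology X d) z l sequentially))"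

definition almost_selfclosed ::
  "'a set \<Rightarrow> ('a \<Rightarrow> 'a \<Rightarrow> real) \<Rightarrow> ('a \<Rightarrow> 'a \<Rightarrow> bool) \<Rightarrow> bool" where
  "almost_selfclosed X d R \<longleftrightarrow>
     (\<forall>z l. ascending_in X R z \<and> limitin (Metric_space.mtopology X d) z l sequentially \<longrightarrow>
        (\<exists>r :: nat \<Rightarrow> nat. strict_mono r \<and> (\<forall>n. R (z (r n)) l)))"

definition increasing_on :: "'a set \<Rightarrow> ('a \<Rightarrow> 'a \<Rightarrow> bool) \<Rightarrow> ('a \<Rightarrow> 'a) \<Rightarrow> bool" where
  "increasing_on X R T \<longleftrightarrow> (\<forall>x\<in>X. \<forall>y\<in>X. R x y \<longrightarrow> R (T x) (T y))"

text \<open>In the remaining notions \<open>S\<close> stands for the chain relation of \<open>R\<close>.\<close>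

definition progressive_set :: "'a set \<Rightarrow> ('a \<Rightarrow> 'a) \<Rightarrow> ('a \<Rightarrow> 'a \<Rightarrow> bool) \<Rightarrow> 'a set" where
  "progressive_set X T S = {x \<in> X. S x (T x)}"

definition semi_progressive :: "'a set \<Rightarrow> ('a \<Rightarrow> 'a \<Rightarrow> bool) \<Rightarrow> ('a \<Rightarrow> 'a) \<Rightarrow> bool" where
  "semi_progressive X S T \<longleftrightarrow> progressive_set X T S \<noteq> {}"

definition global_strongly_Picard ::
  "'a set \<Rightarrow> ('a \<Rightarrow> 'a \<Rightarrow> real) \<Rightarrow> ('a \<Rightarrow> 'a \<Rightarrow> bool) \<Rightarrow> ('a \<Rightarrow> 'a) \<Rightarrow> bool" where
  "global_strongly_Picard X d S T \<longleftrightarrow>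
     (\<forall>x\<in>progressive_set X T S.
        \<exists>l. limitin (Metric_space.mtopology X d) (\<lambda>n. (T ^^ n) x) l sequentially \<and>
            l \<in> Fix_on X T) \<and>
     (\<forall>z1\<in>Fix_on X T. \<forall>z2\<in>Fix_on X T. S z1 z2 \<longrightarrow> z1 = z2)"

end

theory Submission
  imports Defs
begin

text \<open>
  The conclusion comes from applying the usual Banach argument to a whole chain instead of a
  single orbit. Suppose that \<open>x = w 0, w 1, \<dots>, w p = T x\<close> links \<open>x\<close> to \<open>T x\<close>. The iterate \<open>T ^^ q\<close>
  maps this chain to one that links \<open>(T ^^ q) x\<close> to \<open>(T ^^ (q + 1)) x\<close>, so the images can be
  concatenated into one infinite ascending sequence \<open>y\<close> with \<open>y (m + p) = T (y m)\<close>
  (\<open>ex_ascending_refinement_of_orbit\<close>). Its consecutive terms are related, which the terms of the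
  orbit itself need not be, so contractivity applies to every step: step lengths shrink at least by the
  factor \<open>c\<close> each time the index advances by \<open>p\<close>. Hence they are summable, \<open>y\<close> is Cauchy, and
  completeness gives a limit \<open>l\<close>, to which the orbit converges as the subsequence \<open>y (n * p)\<close>.
  Almost-selfclosedness relates infinitely many \<open>y m\<close> to \<open>l\<close>; contractivity
  along these indices shows that \<open>T (y m) = y (m + p)\<close> tends to \<open>T l\<close> as well as to \<open>l\<close>, so \<open>l\<close> is
  fixed (\<open>limit_of_shift_orbit_fixed\<close>).

  Two linked fixed points coincide because \<open>T ^^ n\<close> fixes the ends of a chain between them while
  shrinking its length at least by the factor \<open>c ^ n\<close> (\<open>chain_linked_fixpoints_eq\<close>).
\<close>

section \<open>Chains and their images\<close>

text \<open>Counting links from zero makes concatenation of chains a matter of \<open>div\<close> and \<open>mod\<close>.\<close>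

lemma chain_relE:
  assumes "chain_rel X R x y"
  obtains p :: nat and w where "p > 0" "\<And>i. i \<le> p \<Longrightarrow> w i \<in> X" "w 0 = x" "w p = y"
    "\<And>i. i < p \<Longrightarrow> R (w i) (w (Suc i))"
proof -
  obtain k :: nat and z where k: "k \<ge> 2" and z: "\<forall>i\<in>{1..k}. z i \<in> X" "z 1 = x" "z k = y"
      "\<forall>i\<in>{1..k-1}. R (z i) (z (i + 1))"
    using assms unfolding chain_rel_def by blast
  show thesis
    by (rule that[of "k - 1" "\<lambda>i. z (Suc i)"]) (use k z in \<open>auto simp: Suc_le_eq\<close>)
qed

lemma funpow_in_carrier:
  assumes "T \<in> X \<rightarrow> X" "x \<in> X"
  shows "(T ^^ n) x \<in> X"
  using assms by (induction n) auto

lemma increasing_on_funpow: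
  assumes "increasing_on X R T" "T \<in> X \<rightarrow> X" "x \<in> X" "y \<in> X" "R x y"
  shows "R ((T ^^ n) x) ((T ^^ n) y)"
proof (induction n)
  case (Suc n)
  then show ?case
    using assms funpow_in_carrier[of T X] by (simp add: increasing_on_def)
qed (use assms in simp)

text \<open>
  The sequence runs through the chain from \<open>x\<close> to \<open>T x\<close>, then through its image under \<open>T\<close>, then
  through its image under \<open>T ^^ 2\<close>, and so on. Consecutive blocks fit together because the last
  point of the chain is the image of the first.
\<close>

lemma ex_ascending_refinement_of_orbit:
  assumes T: "T \<in> X \<rightarrow> X" and inc: "increasing_on X R T" and "chain_rel X R x (T x)"
  obtains y and p :: nat where "p > 0" "ascending_in X R y"
    "\<And>m. y (m + p) = T (y m)" "\<And>n. y (n * p) = (T ^^ n) x"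
proof -
  obtain p w where p: "p > 0" and wX: "\<And>i. i \<le> p \<Longrightarrow> w i \<in> X" and w: "w 0 = x" "w p = T x"
    and R: "\<And>i. i < p \<Longrightarrow> R (w i) (w (Suc i))"
    using assms(3) by (rule chain_relE) blast
  define y where "y m = (T ^^ (m div p)) (w (m mod p))" for m
  have y_Suc: "y (Suc m) = (T ^^ (m div p)) (w (Suc (m mod p)))" for m
  proof (cases "Suc (m mod p) = p")
    case True
    then show ?thesis
      by (simp add: y_def div_Suc mod_Suc w funpow_swap1)
  next
    case False
    then show ?thesis
      by (simp add: y_def div_Suc mod_Suc)
  qed
  have mod_less: "m mod p < p" for m
    using p by simp
  have "y m \<in> X" for m
    unfolding y_def by (intro funpow_in_carrier[OF T] wX less_imp_le mod_less)
  moreover have "R (y m) (y (Suc m))" for m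
    unfolding y_Suc unfolding y_def
    using mod_less[of m] by (intro increasing_on_funpow[OF inc T] wX R) auto
  ultimately have "ascending_in X R y"
    by (auto simp: ascending_in_def)
  moreover have "y (m + p) = T (y m)" for m
    using p by (simp add: y_def)
  moreover have "y (n * p) = (T ^^ n) x" for n
    using p by (simp add: y_def w)
  ultimately show thesis
    using that p by blast
qed

section \<open>Convergence\<close>

text \<open>
  If \<open>S n\<close> is the \<open>n\<close>th partial sum, then \<open>S (n + p) \<le> S p + c * S n \<le> S p + c * S (n + p)\<close>, so all
  partial sums are bounded by \<open>S p / (1 - c)\<close>.
\<close>

lemma summable_if_contracting_shift:
  fixes a :: "nat \<Rightarrow> real"
  assumes nonneg: "\<And>n. 0 \<le> a n" and c: "0 \<le> c" "c < 1" and shift: "\<And>n. a (n + p) \<le> c * a n"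
  shows "summable a"
proof (rule bounded_imp_summable[OF nonneg])
  let ?S = "\<lambda>n. \<Sum>k<n. a k"
  fix n
  have mono: "?S m \<le> ?S m'" if "m \<le> m'" for m m'
    using that nonneg by (intro sum_mono2) auto
  have bound: "?S (n + p) \<le> ?S p / (1 - c)" for n
  proof -
    have "?S (n + p) = ?S p + (\<Sum>k<n. a (k + p))"
      by (induction n) (simp_all add: add_ac)
    also have "\<dots> \<le> ?S p + c * ?S n"
      by (simp add: sum_distrib_left sum_mono shift)
    also have "\<dots> \<le> ?S p + c * ?S (n + p)"
      using c mono[of n "n + p"] by (simp add: mult_left_mono)
    finally show ?thesis
      using c by (simp add: field_simps)
  qed
  have "?S (Suc n) \<le> ?S (Suc n + p)"
    by (rule mono) simp
  with bound[of "Suc n"] show "sum a {..n} \<le> ?S p / (1 - c)"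
    by (simp add: lessThan_Suc_atMost)
qed

context Metric_space
begin

lemma dist_le_path_length:
  assumes "\<And>i. i \<le> n \<Longrightarrow> f i \<in> M"
  shows "d (f 0) (f n) \<le> (\<Sum>i<n. d (f i) (f (Suc i)))"
  using assms
proof (induction n)
  case (Suc n)
  then have "d (f 0) (f (Suc n)) \<le> d (f 0) (f n) + d (f n) (f (Suc n))"
    by (intro triangle) auto
  with Suc show ?case
    by force
qed simp

lemma MCauchy_if_summable_steps:
  assumes f: "range f \<subseteq> M" and "summable (\<lambda>i. d (f i) (f (Suc i)))"
  shows "MCauchy f"
  unfolding MCauchy_def
proof (intro conjI f allI impI)
  fix e :: real
  assume "e > 0"
  let ?a = "\<lambda>i. d (f i) (f (Suc i))"
  obtain N where N: "\<And>m n. m \<ge> N \<Longrightarrow> norm (sum ?a {m..<n}) < e"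
    using assms(2) \<open>e > 0\<close> unfolding summable_Cauchy by blast
  have *: "d (f m) (f n) < e" if "N \<le> m" "m \<le> n" for m n
  proof -
    have "d (f (m + 0)) (f (m + (n - m))) \<le> (\<Sum>i<n - m. d (f (m + i)) (f (m + Suc i)))"
      using f by (intro dist_le_path_length[where f = "\<lambda>i. f (m + i)"]) auto
    also have "\<dots> = sum ?a {m..<n}"
      using that by (simp add: sum.atLeastLessThan_shift_0[of _ m n] atLeast0LessThan add_ac)
    also have "\<dots> < e"
      using N[OF that(1), of n] by (simp add: sum_nonneg)
    finally show ?thesis
      using that by simp
  qed
  have "d (f m) (f n) < e" if "N \<le> m" "N \<le> n" for m n
    using *[of m n] *[of n m] that commute[of "f m" "f n"] by (cases "m \<le> n") auto
  then show "\<exists>N. \<forall>m n. N \<le> m \<longrightarrow> N \<le> n \<longrightarrow> d (f m) (f n) < e"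
    by blast
qed

lemma MCauchy_shift_orbit:
  assumes contr: "contractive_on M d R c T" and c: "0 \<le> c" "c < 1"
    and asc: "ascending_in M R y" and shift: "\<And>m. y (m + p) = T (y m)"
  shows "MCauchy y"
proof (rule MCauchy_if_summable_steps)
  show "range y \<subseteq> M"
    using asc by (simp add: ascending_in_def)
  have "d (y (m + p)) (y (Suc (m + p))) \<le> c * d (y m) (y (Suc m))" for m
    using asc contr shift[of m] shift[of "Suc m"]
    by (auto simp: ascending_in_def contractive_on_def image_subset_iff)
  then show "summable (\<lambda>i. d (y i) (y (Suc i)))"
    using c by (intro summable_if_contracting_shift[where c = c and p = p]) auto
qed

text \<open>
  The map \<open>T\<close> need not be continuous at \<open>l\<close>: contractivity controls distances to \<open>T l\<close> only at points related
  to \<open>l\<close>, and almost-selfclosedness supplies infinitely many of these along the sequence.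
\<close>

lemma limit_of_shift_orbit_fixed:
  assumes T: "T \<in> M \<rightarrow> M" and contr: "contractive_on M d R c T" and c: "0 \<le> c" "c < 1"
    and closed: "almost_selfclosed M d R"
    and asc: "ascending_in M R y" and shift: "\<And>m. y (m + p) = T (y m)"
    and lim: "limitin mtopology y l sequentially"
  shows "T l = l"
proof -
  obtain r :: "nat \<Rightarrow> nat" where r: "strict_mono r" and rl: "\<And>n. R (y (r n)) l"
    using closed asc lim unfolding almost_selfclosed_def by blast
  have y: "y m \<in> M" for m
    using asc by (auto simp: ascending_in_def)
  have l: "l \<in> M"
    using lim limitin_mspace by blast
  have "limitin mtopology (\<lambda>n. y (r n + p)) l sequentially"
    using limitin_subsequence[of "\<lambda>n. r n + p"] r lim
    by (fastforce simp: strict_mono_def o_def)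
  moreover have "limitin mtopology (\<lambda>n. y (r n + p)) (T l) sequentially"
    unfolding limit_metric_sequentially
  proof (intro conjI allI impI)
    fix e :: real
    assume "e > 0"
    moreover have "limitin mtopology (\<lambda>n. y (r n)) l sequentially"
      using limitin_subsequence[OF r lim] by (simp add: o_def)
    ultimately obtain N where N: "\<And>n. n \<ge> N \<Longrightarrow> d (y (r n)) l < e"
      unfolding limit_metric_sequentially by blast
    have "d (y (r n + p)) (T l) < e" if "n \<ge> N" for n
    proof -
      have "d (y (r n + p)) (T l) \<le> c * d (y (r n)) l"
        using contr y l rl by (simp add: shift contractive_on_def)
      also have "\<dots> \<le> d (y (r n)) l"
        using c by (simp add: mult_left_le_one_le)
      finally show ?thesis
        using N[OF that] by simp
    qed
    then show "\<exists>N. \<forall>n\<ge>N. y (r n + p) \<in> M \<and> d (y (r n + p)) (T l) < e"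
      using y by blast
  qed (use T l in auto)
  ultimately show ?thesis
    using limitin_metric_unique by (metis trivial_limit_sequentially)
qed

section \<open>Uniqueness within a chain component\<close>

lemma contractive_on_funpow:
  assumes contr: "contractive_on M d R c T" and T: "T \<in> M \<rightarrow> M" and inc: "increasing_on M R T"
    and c: "0 \<le> c" and xy: "x \<in> M" "y \<in> M" "R x y"
  shows "d ((T ^^ n) x) ((T ^^ n) y) \<le> c ^ n * d x y"
proof (induction n)
  case (Suc n)
  have "d ((T ^^ Suc n) x) ((T ^^ Suc n) y) \<le> c * d ((T ^^ n) x) ((T ^^ n) y)"
    using contr funpow_in_carrier[OF T] increasing_on_funpow[OF inc T xy] xy
    by (simp add: contractive_on_def)
  also have "\<dots> \<le> c * (c ^ n * d x y)"
    using c Suc by (rule mult_left_mono[rotated])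
  finally show ?case
    by (simp add: mult.assoc)
qed simp

lemma chain_linked_fixpoints_eq:
  assumes contr: "contractive_on M d R c T" and T: "T \<in> M \<rightarrow> M" and inc: "increasing_on M R T"
    and c: "0 \<le> c" "c < 1"
    and fix_x: "x \<in> Fix_on M T" and fix_y: "y \<in> Fix_on M T" and "chain_rel M R x y"
  shows "x = y"
proof -
  obtain p w where wM: "\<And>i. i \<le> p \<Longrightarrow> w i \<in> M" and w: "w 0 = x" "w p = y"
    and R: "\<And>i. i < p \<Longrightarrow> R (w i) (w (Suc i))"
    using \<open>chain_rel M R x y\<close> by (rule chain_relE) blast
  define D where "D = (\<Sum>i<p. d (w i) (w (Suc i)))"
  have funpow_fixed: "(T ^^ n) z = z" if "z \<in> Fix_on M T" for n z
    using that by (induction n) (auto simp: Fix_on_def)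
  have "d x y \<le> c ^ n * D" for n
  proof -
    have "d x y = d ((T ^^ n) (w 0)) ((T ^^ n) (w p))"
      by (simp add: w funpow_fixed fix_x fix_y)
    also have "\<dots> \<le> (\<Sum>i<p. d ((T ^^ n) (w i)) ((T ^^ n) (w (Suc i))))"
      by (intro dist_le_path_length[where f = "\<lambda>i. (T ^^ n) (w i)"] funpow_in_carrier[OF T] wM)
    also have "\<dots> \<le> (\<Sum>i<p. c ^ n * d (w i) (w (Suc i)))"
      by (intro sum_mono contractive_on_funpow[OF contr T inc] c wM R) auto
    finally show ?thesis
      by (simp add: D_def sum_distrib_left)
  qed
  moreover have "(\<lambda>n. c ^ n * D) \<longlonglongrightarrow> 0"
    using c by (intro tendsto_mult_left_zero LIMSEQ_power_zero) simp
  ultimately have "d x y \<le> 0"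
    by (intro LIMSEQ_le_const) auto
  then show ?thesis
    using fix_x fix_y zero[of x y] nonneg[of x y] by (auto simp: Fix_on_def)
qed

end

section \<open>The relational contraction theorem\<close>

theorem theorem5p3:
  fixes X :: "'a set" and d :: "'a \<Rightarrow> 'a \<Rightarrow> real"
    and le :: "'a \<Rightarrow> 'a \<Rightarrow> bool" and T :: "'a \<Rightarrow> 'a"
  assumes "X \<noteq> {}"
    and "Metric_space X d"
    and "reflp_on X le" and "transp_on X le"
    and "T \<in> X \<rightarrow> X"
    and "\<exists>c. 0 < c \<and> c < 1 \<and> contractive_on X d (comparable le) c T"
    and "rel_complete X d (comparable le)"
    and "almost_selfclosed X d (comparable le)"
    and "increasing_on X (comparable le) T"
    and "semi_progressive X (chain_rel X (comparable le)) T"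
  shows "global_strongly_Picard X d (chain_rel X (comparable le)) T"
proof -
  interpret Metric_space X d
    by fact
  let ?R = "comparable le"
  obtain c where c: "0 \<le> c" "c < 1" and contr: "contractive_on X d ?R c T"
    using assms(6) by (auto intro: less_imp_le)
  note T = \<open>T \<in> X \<rightarrow> X\<close> and inc = \<open>increasing_on X ?R T\<close>
  show ?thesis
    unfolding global_strongly_Picard_def
  proof (intro conjI ballI impI)
    fix x
    assume "x \<in> progressive_set X T (chain_rel X ?R)"
    then have "chain_rel X ?R x (T x)"
      by (simp add: progressive_set_def)
    then obtain y p where p: "p > 0" and asc: "ascending_in X ?R y"
      and shift: "\<And>m. y (m + p) = T (y m)" and orbit: "\<And>n. y (n * p) = (T ^^ n) x"
      by (rule ex_ascending_refinement_of_orbit[OF T inc]) blast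
    have "MCauchy y"
      by (rule MCauchy_shift_orbit[OF contr c asc shift])
    then obtain l where lim: "limitin mtopology y l sequentially"
      using asc \<open>rel_complete X d ?R\<close> unfolding rel_complete_def by blast
    have "strict_mono (\<lambda>n. n * p)"
      using p by (simp add: strict_mono_def)
    then have "limitin mtopology (\<lambda>n. (T ^^ n) x) l sequentially"
      using limitin_subsequence[OF _ lim, of "\<lambda>n. n * p"] by (simp add: o_def orbit)
    moreover have "T l = l"
      by (rule limit_of_shift_orbit_fixed[OF T contr c _ asc shift lim]) fact
    moreover have "l \<in> X"
      using lim limitin_mspace by blast
    ultimately show "\<exists>l. limitin mtopology (\<lambda>n. (T ^^ n) x) l sequentially \<and> l \<in> Fix_on X T"
      by (auto simp: Fix_on_def)
  next
    fix z1 z2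
    assume "z1 \<in> Fix_on X T" "z2 \<in> Fix_on X T" "chain_rel X ?R z1 z2"
    then show "z1 = z2"
      by (rule chain_linked_fixpoints_eq[OF contr T inc c])
  qed
qed

end
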